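(* Let $k\geq1$ and $\alpha>0$ be real numbers. Define $$W(t)=\frac{k^{\frac{t}{k}}\,e^{t\left(\frac{k\gamma-\gamma}{k}\right)}\,\Gamma(\alpha+t)}{\Gamma_k(\alpha+t)},\qquad t\in(0,\infty).$$ Then $W$ is increasing (in the weak sense, i.e. non-decreasing) on $(0,\infty)$, and for every $t\in(0,1)$, $$\frac{k^{-\frac{t}{k}}e^{-t\left(\frac{k\gamma-\gamma}{k}\right)}\Gamma(\alpha)}{\Gamma_k(\alpha)}\leq\frac{\Gamma(\alpha+t)}{\Gamma_k(\alpha+t)}\leq\frac{k^{\frac{1-t}{k}}e^{(1-t)\left(\frac{k\gamma-\gamma}{k}\right)}\Gamma(\alpha+1)}{\Gamma_k(\alpha+1)}.$$
   Context: For $t>0$, $\Gamma(t)=\int_0^\infty e^{-x}x^{t-1}\,dx$ is the classical Gamma function. For $k>0$ and $t>0$, the $k$-Gamma function is $\Gamma_k(t)=\int_0^\infty e^{-\frac{x^k}{k}}x^{t-1}\,dx$. The constant $\gamma$ is the Euler–Mascheroni constant. *)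

theory Defs
  imports "HOL-Analysis.Analysis"
begin

(* Meant for k > 0 and t > 0. The integrand is nonnegative, so this Henstock-Kurzweil
   integral agrees with the Lebesgue (and improper Riemann) integral. *)
definition k_Gamma :: "real \<Rightarrow> real \<Rightarrow> real" where
  "k_Gamma k t = integral {0<..} (\<lambda>x. exp (- (x powr k / k)) * x powr (t - 1))"

definition W :: "real \<Rightarrow> real \<Rightarrow> real \<Rightarrow> real" where
  "W k \<alpha> t =
     k powr (t / k) * exp (t * ((k * euler_mascheroni - euler_mascheroni) / k)) * Gamma (\<alpha> + t)
       / k_Gamma k (\<alpha> + t)"

end

(* The substitution u = x^k / k gives Gamma_k(s) = k^(s/k - 1) Gamma(s/k), so up to a constant
   factor W(t) = exp (c s) Gamma(s) / Gamma(s/k) with s = alpha + t and c = gamma (1 - 1/k).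
   With h(s) = psi(s + 1) + gamma = psi(s) + 1/s + gamma, the logarithmic derivative of this
   function is h(s) - h(s/k) / k. Since h is increasing and h(0) = 0, we have
   h(s/k) / k <= h(s/k) <= h(s). The same monotonicity holds for all t > -alpha, and the two
   bounds compare W(t) with W(0) and W(1). *)
theory Submission
  imports Defs
begin

text \<open>The substitution runs from the Gamma integral to the \<open>k_Gamma\<close> integral,
  because convergence of the former is known and the change of variables carries it over to the
  latter.\<close>

lemma Gamma_conv_k_Gamma:
  fixes k t :: real
  assumes k: "k > 0" and t: "t > 0"
  shows "Gamma (t / k) = k powr (1 - t / k) * k_Gamma k t"
proof -
  define f where "f = (\<lambda>u::real. u powr (t / k - 1) / exp u)"
  define g where "g = (\<lambda>x::real. x powr k / k)"
  define g' where "g' = (\<lambda>x::real. x powr (k - 1))"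
  have "(f has_integral Gamma (t / k)) {0..}"
    unfolding f_def by (rule Gamma_integral_real) (use k t in simp)
  \<comment> \<open>Passing to the open half-line drops only the null set {0}, where
    \<open>g\<close> need not be differentiable if k < 1.\<close>
  moreover have "negligible {x \<in> {0::real..} - {0<..}. f x \<noteq> 0}"
    by (rule negligible_subset[of "{0}"]) auto
  moreover have "negligible {x \<in> {0<..} - {0::real..}. f x \<noteq> 0}"
    by (rule negligible_subset[of "{}"]) auto
  ultimately have int: "(f has_integral Gamma (t / k)) {0<..}"
    using has_integral_spike_set_eq by blast
  hence abs_int: "f absolutely_integrable_on {0<..}"
    by (intro nonnegative_absolutely_integrable_1) (auto simp: f_def integrable_on_def)
  have deriv: "(g has_field_derivative g' x) (at x within {0<..})" if "x \<in> {0<..}" for x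
    using that k unfolding g_def g'_def
    by (auto intro!: derivative_eq_intros simp: powr_diff field_simps)
  have inj: "inj_on g {0<..}"
    by (rule inj_on_inverseI[of _ "\<lambda>u. (k * u) powr (1 / k)"])
      (use k in \<open>auto simp: g_def powr_powr\<close>)
  have image: "g ` {0<..} = {0<..}"
  proof (intro equalityI subsetI)
    fix u :: real assume u: "u \<in> {0<..}"
    hence "u = g ((k * u) powr (1 / k))"
      using k by (simp add: g_def powr_powr)
    moreover have "(k * u) powr (1 / k) \<in> {0<..}"
      using u k by simp
    ultimately show "u \<in> g ` {0<..}" by (rule image_eqI)
  qed (use k in \<open>auto simp: g_def\<close>)
  have "Gamma (t / k) = integral {0<..} (\<lambda>x. \<bar>g' x\<bar> * f (g x))"
    using has_absolute_integral_change_of_variables_1'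
        [of "{0<..}" g g' f "Gamma (t / k)"] deriv inj abs_int int
    by (simp add: image integral_unique)
  also have "\<dots> = integral {0<..}
      (\<lambda>x. k powr (1 - t / k) * (exp (- (x powr k / k)) * x powr (t - 1)))"
  proof (rule integral_cong)
    fix x :: real assume x: "x \<in> {0<..}"
    \<comment> \<open>With p = t/k - 1, the power of u contributes the exponent k (t/k - 1) and the
      Jacobian contributes k - 1. They add up to t - 1, and the constant k^(1 - t/k)
      remains.\<close>
    have split: "(x powr k / k) powr p = x powr (k * p) * k powr (- p)" for p
      using x k by (simp add: powr_divide powr_powr powr_minus_divide)
    have "x powr (k - 1) * (x powr k / k) powr (t / k - 1) =
        k powr (1 - t / k) * x powr (k - 1 + k * (t / k - 1))"
      unfolding split powr_add by simp
    also have "k - 1 + k * (t / k - 1) = t - 1"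
      using k by (simp add: field_simps)
    finally show "\<bar>g' x\<bar> * f (g x) =
        k powr (1 - t / k) * (exp (- (x powr k / k)) * x powr (t - 1))"
      by (simp add: f_def g_def g'_def exp_minus field_simps)
  qed
  also have "\<dots> = k powr (1 - t / k) * k_Gamma k t"
    by (simp add: k_Gamma_def)
  finally show ?thesis .
qed

lemma k_Gamma_conv_Gamma:
  fixes k t :: real
  assumes "k > 0" and "t > 0"
  shows "k_Gamma k t = k powr (t / k - 1) * Gamma (t / k)"
  using assms by (simp add: Gamma_conv_k_Gamma flip: powr_add mult.assoc)

text \<open>Shifting the argument by 1 removes the pole of \<open>Digamma\<close> at 0. In h(x/k)/k
  \<le> h(x) both sides contain the same term 1/x, which cancels, and the Euler constants leave
  \<gamma> - \<gamma>/k.\<close>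

lemma Digamma_scaled_le:
  fixes k x :: real
  assumes k: "k \<ge> 1" and x: "x > 0"
  shows "Digamma (x / k) / k \<le> Digamma x + (k * euler_mascheroni - euler_mascheroni) / k"
proof -
  define h where "h = (\<lambda>y::real. Digamma (y + 1) + euler_mascheroni)"
  have h_eq: "h y = Digamma y + 1 / y + euler_mascheroni" if "y > 0" for y
    using that by (simp add: h_def Digamma_plus1)
  \<comment> \<open>Since \<open>Digamma 1\<close> is -\<gamma>, this says that h(x/k) is
    nonnegative, so that dividing it by k \<ge> 1 cannot increase it.\<close>
  have "Digamma 1 \<le> Digamma (x / k + 1)"
    by (rule Digamma_real_mono) (use k x in auto)
  hence "h (x / k) \<ge> 0"
    by (simp add: h_def)
  hence "h (x / k) / k \<le> h (x / k)"
    using k by (simp add: divide_le_eq mult_left_le mult_le_cancel_left1)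
  also have "h (x / k) \<le> h x"
    unfolding h_def using k x
    by (intro add_right_mono Digamma_real_mono) (auto simp: divide_le_eq mult_le_cancel_left1 add_pos_pos)
  finally show ?thesis
    using k x by (simp add: h_eq add_divide_distrib diff_divide_distrib)
qed

text \<open>The factors that depend on \<alpha> and k alone are positive and are split off, so
  monotonicity of \<open>W\<close> reduces to that of an exponent in the single variable \<alpha> +
  t, whose derivative is given by \<open>Digamma\<close>.\<close>

lemma W_conv_exp:
  fixes k \<alpha> t :: real
  assumes k: "k > 0" and t: "\<alpha> + t > 0"
  defines "c \<equiv> (k * euler_mascheroni - euler_mascheroni) / k"
  shows "W k \<alpha> t = k powr (1 - \<alpha> / k) * exp (- \<alpha> * c) *
    exp ((\<alpha> + t) * c + ln_Gamma (\<alpha> + t) - ln_Gamma ((\<alpha> + t) / k))"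
proof -
  have "k powr (t / k) = k powr (1 - \<alpha> / k) * k powr ((\<alpha> + t) / k - 1)"
    by (simp add: add_divide_distrib flip: powr_add)
  moreover have "exp (t * c) = exp (- \<alpha> * c) * exp ((\<alpha> + t) * c)"
    by (simp add: algebra_simps flip: exp_add)
  moreover have "Gamma (\<alpha> + t) = exp (ln_Gamma (\<alpha> + t))"
    "Gamma ((\<alpha> + t) / k) = exp (ln_Gamma ((\<alpha> + t) / k))"
    using k t by (auto intro: Gamma_real_pos_exp)
  ultimately show ?thesis
    using k t unfolding W_def c_def[symmetric]
    by (simp add: k_Gamma_conv_Gamma exp_add exp_diff)
qed

text \<open>Only \<alpha> + s has to be positive, so s = 0 is allowed; the lower bound of the
  theorem needs this endpoint.\<close>

lemma W_mono:
  fixes k \<alpha> s t :: real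
  assumes k: "k \<ge> 1" and s: "\<alpha> + s > 0" and st: "s \<le> t"
  shows "W k \<alpha> s \<le> W k \<alpha> t"
proof -
  define c where "c = (k * euler_mascheroni - euler_mascheroni) / k"
  define L where "L = (\<lambda>x::real. x * c + ln_Gamma x - ln_Gamma (x / k))"
  have "L (\<alpha> + s) \<le> L (\<alpha> + t)"
  proof (rule DERIV_nonneg_imp_nondecreasing[where f = L])
    fix x :: real assume "\<alpha> + s \<le> x"
    hence x: "x > 0" using s by simp
    have "(L has_real_derivative (c + Digamma x - Digamma (x / k) / k)) (at x)"
      unfolding L_def using x k by (auto intro!: derivative_eq_intros)
    moreover have "c + Digamma x - Digamma (x / k) / k \<ge> 0"
      using Digamma_scaled_le[OF k x] by (simp add: c_def)
    ultimately show "\<exists>y. (L has_real_derivative y) (at x) \<and> y \<ge> 0" by blast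
  qed (use st in simp)
  thus ?thesis
    using k s st by (simp add: W_conv_exp L_def c_def)
qed

theorem theorem3p2:
  fixes k \<alpha> :: real
  assumes "k \<ge> 1" and "\<alpha> > 0"
  shows "mono_on {0<..} (W k \<alpha>) \<and>
    (\<forall>t\<in>{0<..<1}.
       k powr (- t / k) * exp (- t * ((k * euler_mascheroni - euler_mascheroni) / k)) * Gamma \<alpha>
           / k_Gamma k \<alpha>
         \<le> Gamma (\<alpha> + t) / k_Gamma k (\<alpha> + t) \<and>
       Gamma (\<alpha> + t) / k_Gamma k (\<alpha> + t)
         \<le> k powr ((1 - t) / k) * exp ((1 - t) * ((k * euler_mascheroni - euler_mascheroni) / k))
             * Gamma (\<alpha> + 1) / k_Gamma k (\<alpha> + 1))"
proof (intro conjI ballI)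
  show "mono_on {0<..} (W k \<alpha>)"
    using assms by (intro mono_onI W_mono) auto
next
  fix t :: real assume t: "t \<in> {0<..<1}"
  define c where "c = (k * euler_mascheroni - euler_mascheroni) / k"
  have W_eq: "W k \<alpha> u =
      k powr (u / k) * exp (u * c) * (Gamma (\<alpha> + u) / k_Gamma k (\<alpha> + u))" for u
    by (simp add: W_def c_def)
  \<comment> \<open>The weight in front of the Gamma quotient is exponential in its argument. The
    case u = 0 inverts the weight at t for the lower bound, and u = 1 splits the weight at 1 for the
    upper bound.\<close>
  have shift: "k powr ((u - t) / k) * exp ((u - t) * c) *
      (k powr (t / k) * exp (t * c)) = k powr (u / k) * exp (u * c)" for u
  proof -
    have "k powr (u / k) = k powr ((u - t) / k) * k powr (t / k)"
      by (simp add: diff_divide_distrib flip: powr_add)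
    moreover have "exp (u * c) = exp ((u - t) * c) * exp (t * c)"
      by (simp add: algebra_simps flip: exp_add)
    ultimately show ?thesis by (simp add: mult_ac)
  qed
  have inverse: "k powr (- t / k) * exp (- t * c) * (k powr (t / k) * exp (t * c)) = 1"
    using shift[of 0] assms by simp
  have pos: "k powr (t / k) * exp (t * c) > 0"
    using assms by simp
  have "W k \<alpha> 0 \<le> W k \<alpha> t"
    using assms t by (intro W_mono) auto
  hence "k powr (- t / k) * exp (- t * c) * W k \<alpha> 0 \<le> k powr (- t / k) * exp (- t * c) * W k \<alpha> t"
    by (rule mult_left_mono) simp
  also have "\<dots> = Gamma (\<alpha> + t) / k_Gamma k (\<alpha> + t)"
    unfolding W_eq mult.assoc[symmetric]
    using inverse by (simp add: mult.assoc)
  finally show "k powr (- t / k) * exp (- t * ((k * euler_mascheroni - euler_mascheroni) / k)) * Gamma \<alpha>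
           / k_Gamma k \<alpha> \<le> Gamma (\<alpha> + t) / k_Gamma k (\<alpha> + t)"
    using assms by (simp add: W_eq c_def)
  have "W k \<alpha> t \<le> W k \<alpha> 1"
    using assms t by (intro W_mono) auto
  \<comment> \<open>Both sides now carry the positive weight at t as a common factor, which is then
    cancelled.\<close>
  hence "(k powr (t / k) * exp (t * c)) * (Gamma (\<alpha> + t) / k_Gamma k (\<alpha> + t)) \<le>
      (k powr (t / k) * exp (t * c)) * (k powr ((1 - t) / k) * exp ((1 - t) * c) *
        Gamma (\<alpha> + 1) / k_Gamma k (\<alpha> + 1))"
    unfolding W_eq shift[of 1, symmetric] by (simp only: mult_ac times_divide_eq_right)
  thus "Gamma (\<alpha> + t) / k_Gamma k (\<alpha> + t) \<le>
      k powr ((1 - t) / k) * exp ((1 - t) * ((k * euler_mascheroni - euler_mascheroni) / k))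
             * Gamma (\<alpha> + 1) / k_Gamma k (\<alpha> + 1)"
    unfolding c_def[symmetric] using pos by (simp only: mult_le_cancel_left_pos)
qed

end
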